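(* Let $\mathbf n$ be a strictly increasing sequence of positive integers and let $\mathcal B=(e_n)$ be a basis of a Banach space $X$. The following are equivalent: (i) $\mathcal B$ is $1$-($\mathbf n$, PSLC). (ii) $\mathcal B$ satisfies the following two conditions simultaneously: (a) for all $x\in X$ with $\|x\|_\infty\le1$ and all $k\notin\operatorname{supp}(x)$, $\|x\|\le\|x+e_k\|$; (b) for all $x\in X$ with $\|x\|_\infty\le1$, all $s,t\in\mathbb F$ with $|s|=|t|=1$, all $j\in\mathbf n$ and all $k\in\mathbb N\setminus\operatorname{supp}(x)$ such that $j$ is strictly smaller than every element of $(\{k\}\cup\operatorname{supp}(x))\cap\mathbf n$, one has $\|x+se_j\|\le\|x+te_k\|$.
   Context: $X$ is a separable infinite-dimensional Banach space over $\mathbb F=\mathbb R$ or $\mathbb C$; $\mathbb N=\{1,2,\dots\}$. A basis of $X$ is a sequence $\mathcal B=(e_n)_{n\ge1}\subset X$ whose linear span is norm-dense and for which there is a sequence $(e_n^* )_{n\ge1}\subset X^*$ with $e_j^*(e_k)=\delta_{j,k}$ and $0<\inf_n\{\|e_n\|,\|e_n^*\|\}\le\sup_n\{\|e_n\|,\|e_n^*\|\}<\infty$ (then $e_n^*(x)\to0$ for every $x$). The sequence $\mathbf n$ is identified with its set of terms. A sign is a sequence $\varepsilon=(\varepsilon_n)_n$ of scalars of modulus $1$; $1_{\varepsilon A}=\sum_{n\in A}\varepsilon_ne_n$ for finite $A$; $\|x\|_\infty=\max_n|e_n^*(x)|$; $\operatorname{supp}(x)=\{n:e_n^*(x)\ne0\}$;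 $A<B$ means $a<b$ for all $a\in A,b\in B$ (vacuous if one is empty). $\mathcal B$ is $1$-($\mathbf n$, PSLC) if $\|x+1_{\varepsilon A}\|\le\|x+1_{\delta B}\|$ for all $x\in X$ with $\|x\|_\infty\le1$, all finite sets $A\subset\mathbf n$, $B\subset\mathbb N$ with $|A|\le|B|$, $B\cap\operatorname{supp}(x)=\emptyset$ and $A<(B\cup\operatorname{supp}(x))\cap\mathbf n$, and all signs $\varepsilon,\delta$. *)

theory Defs
  imports "HOL-Analysis.Analysis"
begin

text \<open>
  The scalars are a type of class \<open>real_normed_field\<close>. This covers \<open>real\<close> and \<open>complex\<close>, and by the
  Gelfand--Mazur theorem these are, up to isometric isomorphism, its only instances.
  The class \<open>banach\<close> supplies the underlying real Banach space.
\<close>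

locale separable_inf_dim_banach_space = vector_space smul
  for smul :: "'f::real_normed_field \<Rightarrow> 'a::banach \<Rightarrow> 'a" +
  assumes smul_of_real: "smul (of_real r) x = r *\<^sub>R x"
    and norm_smul: "norm (smul c x) = norm c * norm x"
    and separable: "\<exists>D::'a set. countable D \<and> closure D = UNIV"
    and infinite_dim: "\<nexists>S. finite S \<and> module.span smul S = UNIV"

text \<open>
  Sequences are indexed by the positive integers: a function on \<open>nat\<close> represents a sequence
  through its values on \<open>{1..}\<close>, and its value at \<open>0\<close> is irrelevant throughout.
\<close>

text \<open>The topological dual, over the scalar field \<open>'f\<close>: \<open>blinfun\<close> only gives real linearity.\<close>

definition dual :: "('f::real_normed_field \<Rightarrow> 'a::banach \<Rightarrow> 'a) \<Rightarrow> ('a \<Rightarrow>\<^sub>L 'f) set"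
  where "dual smul = {f. \<forall>c x. blinfun_apply f (smul c x) = c * blinfun_apply f x}"

definition coordinate_functionals ::
  "('f::real_normed_field \<Rightarrow> 'a::banach \<Rightarrow> 'a) \<Rightarrow> (nat \<Rightarrow> 'a) \<Rightarrow> (nat \<Rightarrow> 'a \<Rightarrow>\<^sub>L 'f) \<Rightarrow> bool"
  where "coordinate_functionals smul e es \<longleftrightarrow>
    (\<forall>n\<ge>1. es n \<in> dual smul) \<and>
    (\<forall>j\<ge>1. \<forall>k\<ge>1. blinfun_apply (es j) (e k) = (if j = k then 1 else 0)) \<and>
    0 < Inf (\<Union>n\<in>{1..}. {norm (e n), norm (es n)}) \<and>
    bdd_above (\<Union>n\<in>{1..}. {norm (e n), norm (es n)})"

text \<open>Since the span is dense, the functionals \<open>es n\<close> with \<open>n \<ge> 1\<close> are uniquely determined by \<open>e\<close>.\<close>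

definition is_basis :: "('f::real_normed_field \<Rightarrow> 'a::banach \<Rightarrow> 'a) \<Rightarrow> (nat \<Rightarrow> 'a) \<Rightarrow> bool"
  where "is_basis smul e \<longleftrightarrow>
    closure (module.span smul (e ` {1..})) = UNIV \<and> (\<exists>es. coordinate_functionals smul e es)"

definition is_sign :: "(nat \<Rightarrow> 'f::real_normed_field) \<Rightarrow> bool"
  where "is_sign \<epsilon> \<longleftrightarrow> (\<forall>n\<ge>1. norm (\<epsilon> n) = 1)"

definition signed_indicator ::
  "('f::real_normed_field \<Rightarrow> 'a::banach \<Rightarrow> 'a) \<Rightarrow> (nat \<Rightarrow> 'a) \<Rightarrow> (nat \<Rightarrow> 'f) \<Rightarrow> nat set \<Rightarrow> 'a"
  where "signed_indicator smul e \<epsilon> A = (\<Sum>n\<in>A. smul (\<epsilon> n) (e n))"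

text \<open>
  For a basis the coordinates of \<open>x\<close> tend to \<open>0\<close>, so the supremum below is attained: it is the maximum.
\<close>

definition coord_sup_norm :: "(nat \<Rightarrow> 'a::banach \<Rightarrow>\<^sub>L 'f::real_normed_field) \<Rightarrow> 'a \<Rightarrow> real"
  where "coord_sup_norm es x = (SUP n\<in>{1..}. norm (blinfun_apply (es n) x))"

definition supp :: "(nat \<Rightarrow> 'a::banach \<Rightarrow>\<^sub>L 'f::real_normed_field) \<Rightarrow> 'a \<Rightarrow> nat set"
  where "supp es x = {n. n \<ge> 1 \<and> blinfun_apply (es n) x \<noteq> 0}"

definition set_less :: "nat set \<Rightarrow> nat set \<Rightarrow> bool"
  where "set_less A B \<longleftrightarrow> (\<forall>a\<in>A. \<forall>b\<in>B. a < b)"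

text \<open>The property 1-(\<open>N\<close>, PSLC), where \<open>N\<close> is the set of terms of the sequence.\<close>

definition one_PSLC ::
  "('f::real_normed_field \<Rightarrow> 'a::banach \<Rightarrow> 'a) \<Rightarrow> (nat \<Rightarrow> 'a) \<Rightarrow> (nat \<Rightarrow> 'a \<Rightarrow>\<^sub>L 'f) \<Rightarrow> nat set \<Rightarrow> bool"
  where "one_PSLC smul e es N \<longleftrightarrow>
    (\<forall>x A B \<epsilon> \<delta>.
      coord_sup_norm es x \<le> 1 \<and>
      finite A \<and> A \<subseteq> N \<and> finite B \<and> B \<subseteq> {1..} \<and> card A \<le> card B \<and>
      B \<inter> supp es x = {} \<and> set_less A ((B \<union> supp es x) \<inter> N) \<and>
      is_sign \<epsilon> \<and> is_sign \<delta> \<longrightarrow>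
      norm (x + signed_indicator smul e \<epsilon> A) \<le> norm (x + signed_indicator smul e \<delta> B))"

end

theory Submission
  imports Defs
begin

text \<open>
  The definition of 1-(\<open>N\<close>, PSLC) compares all pairs \<open>A\<close>, \<open>B\<close> with \<open>card A \<le> card B\<close>; conditions (a)
  and (b) are its cases \<open>A = {}\<close>, \<open>B = {k}\<close> and \<open>A = {j}\<close>, \<open>B = {k}\<close>. Conversely, the general
  comparison is a chain of these two. While \<open>A\<close> is nonempty, its least element \<open>j\<close> is
  exchanged by (b) for some \<open>k \<in> B\<close>, the other terms of \<open>A\<close> being counted as part of the vector
  (\<open>norm_exchange\<close>). The new term at \<open>k\<close> is then absorbed into \<open>x\<close>, and the comparison goes on with
  \<open>A - {j}\<close> and \<open>B - {k}\<close>. When \<open>A\<close> is used up, (a) adds what remains of \<open>B\<close> term by term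
  (\<open>norm_le_add_signed_indicator\<close>).

  The order of the exchanges matters: (b) requires \<open>j\<close> to lie below all other elements of \<open>N\<close> in
  sight, including the other elements of \<open>A\<close>, and this is why the minimum is removed first.
  The unit ball of \<open>coord_sup_norm\<close> is never left, because unimodular terms are only ever added at
  positions outside the support.
\<close>

locale banach_space_with_coordinates = separable_inf_dim_banach_space smul
  for smul :: "'f::real_normed_field \<Rightarrow> 'a::banach \<Rightarrow> 'a" +
  fixes e :: "nat \<Rightarrow> 'a" and es :: "nat \<Rightarrow> 'a \<Rightarrow>\<^sub>L 'f"
  assumes coordinates: "coordinate_functionals smul e es"
begin

abbreviation coord :: "nat \<Rightarrow> 'a \<Rightarrow> 'f"
  where "coord n \<equiv> blinfun_apply (es n)"

abbreviation ind :: "(nat \<Rightarrow> 'f) \<Rightarrow> nat set \<Rightarrow> 'a"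
  where "ind \<equiv> signed_indicator smul e"

lemma coord_smul: "n \<ge> 1 \<Longrightarrow> coord n (smul c x) = c * coord n x"
  using coordinates unfolding coordinate_functionals_def dual_def by blast

lemma coord_basis: "n \<ge> 1 \<Longrightarrow> k \<ge> 1 \<Longrightarrow> coord n (e k) = (if n = k then 1 else 0)"
  using coordinates unfolding coordinate_functionals_def by blast

lemma coord_signed_indicator:
  assumes "n \<ge> 1" and "finite A" and "A \<subseteq> {1..}"
  shows "coord n (ind \<epsilon> A) = (if n \<in> A then \<epsilon> n else 0)"
proof -
  have "coord n (ind \<epsilon> A) = (\<Sum>k\<in>A. coord n (smul (\<epsilon> k) (e k)))"
    by (simp add: signed_indicator_def blinfun.sum_right)
  also have "\<dots> = (\<Sum>k\<in>A. if n = k then \<epsilon> k else 0)"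
    using assms by (intro sum.cong) (auto simp: coord_smul coord_basis)
  finally show ?thesis
    using assms by simp
qed

text \<open>
  A real supremum is meaningful only over a bounded set. The bound on the norms of the coordinate
  functionals provides this, so that membership in the unit ball can be checked coordinatewise.
\<close>
lemma coord_sup_norm_le_iff:
  "coord_sup_norm es x \<le> c \<longleftrightarrow> (\<forall>n\<ge>1. norm (coord n x) \<le> c)"
proof -
  obtain M where M: "\<And>n. n \<ge> 1 \<Longrightarrow> norm (es n) \<le> M"
    using coordinates unfolding coordinate_functionals_def bdd_above_def by fastforce
  have "norm (coord n x) \<le> M * norm x" if "n \<ge> 1" for n
    using norm_blinfun[of "es n" x] mult_right_mono[OF M[OF that] norm_ge_zero[of x]] by linarith
  then have "bdd_above ((\<lambda>n. norm (coord n x)) ` {1..})"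
    by (intro bdd_aboveI[of _ "M * norm x"]) auto
  then show ?thesis
    unfolding coord_sup_norm_def by (subst cSUP_le_iff) auto
qed

lemma coord_sup_norm_smul_unimodular:
  assumes "norm c = 1"
  shows "coord_sup_norm es (smul c x) \<le> r \<longleftrightarrow> coord_sup_norm es x \<le> r"
  using assms by (simp add: coord_sup_norm_le_iff coord_smul norm_mult)

lemma supp_smul: "c \<noteq> 0 \<Longrightarrow> supp es (smul c x) = supp es x"
  by (auto simp: supp_def coord_smul)

lemma coord_sup_norm_add_signed_indicator:
  assumes "coord_sup_norm es x \<le> 1" and "finite A" and "A \<subseteq> {1..}"
    and "A \<inter> supp es x = {}" and "is_sign \<epsilon>"
  shows "coord_sup_norm es (x + ind \<epsilon> A) \<le> 1"
  using assms
  by (auto simp: coord_sup_norm_le_iff blinfun.add_right coord_signed_indicator supp_def is_sign_def)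

lemma supp_add_signed_indicator:
  assumes "finite A" and "A \<subseteq> {1..}" and "A \<inter> supp es x = {}" and "is_sign \<epsilon>"
  shows "supp es (x + ind \<epsilon> A) = supp es x \<union> A"
proof -
  have "coord n (x + ind \<epsilon> A) \<noteq> 0 \<longleftrightarrow> coord n x \<noteq> 0 \<or> n \<in> A" if "n \<ge> 1" for n
  proof (cases "n \<in> A")
    case True
    then have "coord n x = 0" and "\<epsilon> n \<noteq> 0"
      using assms that by (auto simp: supp_def is_sign_def)
    then show ?thesis
      using True that assms by (simp add: blinfun.add_right coord_signed_indicator)
  next
    case False
    then show ?thesis
      using that assms by (simp add: blinfun.add_right coord_signed_indicator)
  qed
  then show ?thesis
    using assms(2) by (auto simp: supp_def)
qed

lemma signed_indicator_empty: "ind \<epsilon> {} = 0"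
  by (simp add: signed_indicator_def)

lemma signed_indicator_singleton: "ind \<epsilon> {k} = smul (\<epsilon> k) (e k)"
  by (simp add: signed_indicator_def)

lemma signed_indicator_insert:
  "finite A \<Longrightarrow> k \<notin> A \<Longrightarrow> ind \<epsilon> (insert k A) = ind \<epsilon> {k} + ind \<epsilon> A"
  by (simp add: signed_indicator_def)

text \<open>
  Adding the coefficient 1 is as good as adding any unimodular coefficient \<open>t\<close>: multiplication of
  the whole vector by the inverse of \<open>t\<close> is an isometry preserving the unit ball and the support.
\<close>
lemma norm_le_add_unimodular_multiple:
  assumes a: "\<And>x k. coord_sup_norm es x \<le> 1 \<Longrightarrow> k \<ge> 1 \<Longrightarrow> k \<notin> supp es x \<Longrightarrow> norm x \<le> norm (x + e k)"
    and x: "coord_sup_norm es x \<le> 1" and k: "k \<ge> 1" "k \<notin> supp es x" and t: "norm t = 1"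
  shows "norm x \<le> norm (x + smul t (e k))"
proof -
  have t': "t \<noteq> 0" "norm (inverse t) = 1"
    using t by (auto simp: norm_inverse)
  let ?y = "smul (inverse t) x"
  have "norm ?y \<le> norm (?y + e k)"
    using x k t' by (intro a) (simp_all add: coord_sup_norm_smul_unimodular supp_smul)
  also have "?y + e k = smul (inverse t) (x + smul t (e k))"
    using t' by (simp add: scale_right_distrib)
  finally show ?thesis
    using t' by (simp add: norm_smul)
qed

lemma norm_le_add_signed_indicator:
  assumes a: "\<And>x k. coord_sup_norm es x \<le> 1 \<Longrightarrow> k \<ge> 1 \<Longrightarrow> k \<notin> supp es x \<Longrightarrow> norm x \<le> norm (x + e k)"
    and \<delta>: "is_sign \<delta>" and "finite B" and "coord_sup_norm es x \<le> 1"
    and "B \<subseteq> {1..}" and "B \<inter> supp es x = {}"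
  shows "norm x \<le> norm (x + ind \<delta> B)"
  using assms(3-)
proof (induction B rule: finite_induct)
  case empty
  then show ?case
    by (simp add: signed_indicator_empty)
next
  case (insert k B)
  let ?y = "x + ind \<delta> B"
  have "norm x \<le> norm ?y"
    using insert by auto
  also have "\<dots> \<le> norm (?y + smul (\<delta> k) (e k))"
  proof (rule norm_le_add_unimodular_multiple[OF a])
    show "coord_sup_norm es ?y \<le> 1"
      using insert \<delta> by (intro coord_sup_norm_add_signed_indicator) auto
    have "supp es ?y = supp es x \<union> B"
      using insert \<delta> by (intro supp_add_signed_indicator) auto
    then show "k \<notin> supp es ?y"
      using insert by auto
  qed (use insert \<delta> in \<open>auto simp: is_sign_def\<close>)
  also have "?y + smul (\<delta> k) (e k) = x + ind \<delta> (insert k B)"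
    using insert by (simp add: signed_indicator_insert signed_indicator_singleton ac_simps)
  finally show ?case .
qed

text \<open>
  One exchange: the terms on \<open>A\<close>, which all lie beyond \<open>j\<close>, are made part of the vector to which
  condition (b) is applied. The position \<open>k\<close> is free there because an element of \<open>A\<close> cannot lie
  strictly beyond itself.
\<close>
lemma norm_exchange:
  assumes b: "\<And>x s t j k. coord_sup_norm es x \<le> 1 \<Longrightarrow> norm s = 1 \<Longrightarrow> norm t = 1 \<Longrightarrow> j \<in> N \<Longrightarrow>
      k \<ge> 1 \<Longrightarrow> k \<notin> supp es x \<Longrightarrow> \<forall>i \<in> ({k} \<union> supp es x) \<inter> N. j < i \<Longrightarrow>
      norm (x + smul s (e j)) \<le> norm (x + smul t (e k))"
    and N: "N \<subseteq> {1..}" and \<epsilon>: "is_sign \<epsilon>" and \<delta>: "is_sign \<delta>"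
    and A: "finite A" "insert j A \<subseteq> N" and min: "\<forall>a\<in>A. j < a"
    and x: "coord_sup_norm es x \<le> 1" and k: "k \<ge> 1" "k \<notin> supp es x"
    and less: "set_less (insert j A) ((insert k (supp es x)) \<inter> N)"
  shows "norm (x + ind \<epsilon> (insert j A)) \<le> norm ((x + ind \<delta> {k}) + ind \<epsilon> A)"
proof -
  let ?y = "x + ind \<epsilon> A"
  have disj: "A \<inter> supp es x = {}" "k \<notin> A"
    using less A unfolding set_less_def by blast+
  have supp_y: "supp es ?y = supp es x \<union> A"
    using A N disj \<epsilon> by (intro supp_add_signed_indicator) auto
  have "norm (?y + smul (\<epsilon> j) (e j)) \<le> norm (?y + smul (\<delta> k) (e k))"
  proof (rule b)
    show "coord_sup_norm es ?y \<le> 1"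
      using x A N disj \<epsilon> by (intro coord_sup_norm_add_signed_indicator) auto
    show "norm (\<epsilon> j) = 1" "norm (\<delta> k) = 1"
      using \<epsilon> \<delta> A N k unfolding is_sign_def by auto
    show "\<forall>i \<in> ({k} \<union> supp es ?y) \<inter> N. j < i"
      using less min unfolding supp_y set_less_def by auto
  qed (use A k disj supp_y in auto)
  moreover have "j \<notin> A"
    using min by auto
  ultimately show ?thesis
    using A by (simp add: signed_indicator_insert signed_indicator_singleton ac_simps)
qed

text \<open>
  The induction removes the minimum of \<open>A\<close>. Since the exchanged term becomes part of \<open>x\<close>, the
  hypothesis is needed for all \<open>x\<close>. The order condition survives: \<open>B\<close> and \<open>supp es x\<close> change, but
  their union does not.
\<close>
lemma norm_add_signed_indicator_mono:
  assumes a: "\<And>x k. coord_sup_norm es x \<le> 1 \<Longrightarrow> k \<ge> 1 \<Longrightarrow> k \<notin> supp es x \<Longrightarrow> norm x \<le> norm (x + e k)"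
    and b: "\<And>x s t j k. coord_sup_norm es x \<le> 1 \<Longrightarrow> norm s = 1 \<Longrightarrow> norm t = 1 \<Longrightarrow> j \<in> N \<Longrightarrow>
      k \<ge> 1 \<Longrightarrow> k \<notin> supp es x \<Longrightarrow> \<forall>i \<in> ({k} \<union> supp es x) \<inter> N. j < i \<Longrightarrow>
      norm (x + smul s (e j)) \<le> norm (x + smul t (e k))"
    and N: "N \<subseteq> {1..}" and \<epsilon>: "is_sign \<epsilon>" and \<delta>: "is_sign \<delta>"
    and "finite A" and "A \<subseteq> N" and "coord_sup_norm es x \<le> 1"
    and "finite B" and "B \<subseteq> {1..}" and "card A \<le> card B"
    and "B \<inter> supp es x = {}" and "set_less A ((B \<union> supp es x) \<inter> N)"
  shows "norm (x + ind \<epsilon> A) \<le> norm (x + ind \<delta> B)"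
  using assms(6-)
proof (induction A arbitrary: x B rule: finite_linorder_min_induct)
  case empty
  then show ?case
    using norm_le_add_signed_indicator[OF a \<delta>] by (simp add: signed_indicator_empty)
next
  case (insert j A)
  have "j \<notin> A"
    using insert.hyps by auto
  then have card: "Suc (card A) \<le> card B"
    using insert.prems insert.hyps by simp
  then obtain k where k: "k \<in> B"
    by fastforce
  define B' where "B' = B - {k}"
  have B: "B = insert k B'" "k \<notin> B'" "finite B'"
    using k insert.prems by (auto simp: B'_def)
  let ?x = "x + ind \<delta> {k}"
  have supp': "supp es ?x = supp es x \<union> {k}"
    using insert.prems k \<delta> by (intro supp_add_signed_indicator) auto
  have "norm (x + ind \<epsilon> (insert j A)) \<le> norm (?x + ind \<epsilon> A)"
  proof (rule norm_exchange[OF b N \<epsilon> \<delta>])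
    show "set_less (insert j A) (insert k (supp es x) \<inter> N)"
      using insert.prems k unfolding set_less_def by blast
  qed (use insert.hyps insert.prems k in auto)
  also have "\<dots> \<le> norm (?x + ind \<delta> B')"
  proof (rule insert.IH)
    show "coord_sup_norm es ?x \<le> 1"
      using insert.prems k \<delta> by (intro coord_sup_norm_add_signed_indicator) auto
    show "set_less A ((B' \<union> supp es ?x) \<inter> N)"
      using insert.prems B unfolding supp' set_less_def by blast
    show "card A \<le> card B'"
      using card B by simp
  qed (use insert.prems B supp' in auto)
  also have "?x + ind \<delta> B' = x + ind \<delta> B"
    using B by (simp add: signed_indicator_insert[OF B(3,2)] ac_simps)
  finally show ?case .
qed

lemma one_PSLC_iff_single_comparisons:
  assumes N: "N \<subseteq> {1..}"
  shows "one_PSLC smul e es N \<longleftrightarrow>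
    (\<forall>x k. coord_sup_norm es x \<le> 1 \<and> k \<ge> 1 \<and> k \<notin> supp es x \<longrightarrow> norm x \<le> norm (x + e k)) \<and>
    (\<forall>x s t j k. coord_sup_norm es x \<le> 1 \<and> norm s = 1 \<and> norm t = 1 \<and>
       j \<in> N \<and> k \<ge> 1 \<and> k \<notin> supp es x \<and> (\<forall>i \<in> ({k} \<union> supp es x) \<inter> N. j < i) \<longrightarrow>
       norm (x + smul s (e j)) \<le> norm (x + smul t (e k)))"
    (is "?PSLC \<longleftrightarrow> ?a \<and> ?b")
proof (intro iffI conjI allI impI; (elim conjE)?)
  fix x k
  assume PSLC: "?PSLC" and "coord_sup_norm es x \<le> 1" "k \<ge> 1" "k \<notin> supp es x"
  then have "norm (x + ind (\<lambda>_. 1) {}) \<le> norm (x + ind (\<lambda>_. 1) {k})"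
    by (intro PSLC[unfolded one_PSLC_def, rule_format]) (auto simp: set_less_def is_sign_def)
  then show "norm x \<le> norm (x + e k)"
    by (simp add: signed_indicator_empty signed_indicator_singleton)
next
  fix x j k and s t :: 'f
  assume PSLC: "?PSLC" and "coord_sup_norm es x \<le> 1" "norm s = 1" "norm t = 1" "j \<in> N"
    "k \<ge> 1" "k \<notin> supp es x" "\<forall>i \<in> ({k} \<union> supp es x) \<inter> N. j < i"
  then have "norm (x + ind (\<lambda>_. s) {j}) \<le> norm (x + ind (\<lambda>_. t) {k})"
    by (intro PSLC[unfolded one_PSLC_def, rule_format]) (auto simp: set_less_def is_sign_def)
  then show "norm (x + smul s (e j)) \<le> norm (x + smul t (e k))"
    by (simp add: signed_indicator_singleton)
next
  assume a: "?a" and b: "?b"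
  show "?PSLC"
    unfolding one_PSLC_def
  proof (intro allI impI, elim conjE)
    fix x A B and \<epsilon> \<delta> :: "nat \<Rightarrow> 'f"
    assume "coord_sup_norm es x \<le> 1" "finite A" "A \<subseteq> N" "finite B" "B \<subseteq> {1..}" "card A \<le> card B"
      "B \<inter> supp es x = {}" "set_less A ((B \<union> supp es x) \<inter> N)" "is_sign \<epsilon>" "is_sign \<delta>"
    then show "norm (x + ind \<epsilon> A) \<le> norm (x + ind \<delta> B)"
      using norm_add_signed_indicator_mono[OF a[rule_format, OF conjI, OF _ conjI]
          b[rule_format, OF conjI, OF _ conjI, OF _ _ conjI, OF _ _ _ conjI,
            OF _ _ _ _ conjI, OF _ _ _ _ _ conjI] N]
      by blast
  qed
qed

end

theorem proposition5p2:
  fixes smul :: "'f::real_normed_field \<Rightarrow> 'a::banach \<Rightarrow> 'a"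
    and e :: "nat \<Rightarrow> 'a"
    and es :: "nat \<Rightarrow> 'a \<Rightarrow>\<^sub>L 'f"
    and nn :: "nat \<Rightarrow> nat"
    and N :: "nat set"
  assumes "separable_inf_dim_banach_space smul"
    and "is_basis smul e"
    and "coordinate_functionals smul e es"
    and "strict_mono_on {1..} nn"
    and "\<forall>i\<ge>1. nn i \<ge> 1"
    and "N = nn ` {1..}"
  shows "one_PSLC smul e es N \<longleftrightarrow>
    (\<forall>x k. coord_sup_norm es x \<le> 1 \<and> k \<ge> 1 \<and> k \<notin> supp es x \<longrightarrow> norm x \<le> norm (x + e k)) \<and>
    (\<forall>x s t j k. coord_sup_norm es x \<le> 1 \<and> norm s = 1 \<and> norm t = 1 \<and>
       j \<in> N \<and> k \<ge> 1 \<and> k \<notin> supp es x \<and> (\<forall>i \<in> ({k} \<union> supp es x) \<inter> N. j < i) \<longrightarrow>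
       norm (x + smul s (e j)) \<le> norm (x + smul t (e k)))"
proof -
  interpret separable_inf_dim_banach_space smul
    by (rule assms(1))
  interpret banach_space_with_coordinates smul e es
    by unfold_locales (rule assms(3))
  show ?thesis
    using assms(5,6) by (intro one_PSLC_iff_single_comparisons) auto
qed

end
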